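(* Let $A$ be a unital (associative) algebra over a field $F$ with $\operatorname{char}(F)=0$. If $1\in [A,A]$, then $[A,A]\subseteq \operatorname{span} f(A)$ for every nonconstant polynomial $f\in F\langle \mathcal X\rangle$.
   Context: $F\langle \mathcal X\rangle$ is the free (unital, associative) algebra over $F$ on $\mathcal X=\{X_1,X_2,\dots\}$, i.e. the algebra of noncommutative polynomials. For $f=f(X_1,\dots,X_m)\in F\langle\mathcal X\rangle$, $f(A)=\{f(a_1,\dots,a_m)\mid a_1,\dots,a_m\in A\}$, and $\operatorname{span} f(A)$ is its $F$-linear span. $[A,A]$ is the $F$-linear span of all commutators $[x,y]=xy-yx$ with $x,y\in A$. *)

theory Defs
  imports Complex_Main "HOL-Library.Poly_Mapping"
begin

section \<open>Unital associative algebras over a field\<close>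

text \<open>
  The sort \<open>{ring, monoid_mult}\<close> describes unital associative rings without the requirement
  \<open>0 \<noteq> 1\<close> that is built into \<open>ring_1\<close>, so the zero algebra is not excluded.
\<close>

locale unital_algebra = vector_space scale
  for scale :: "'f::field \<Rightarrow> 'a::{ring,monoid_mult} \<Rightarrow> 'a" +
  assumes scale_mult_left: "scale c x * y = scale c (x * y)"
    and scale_mult_right: "x * scale c y = scale c (x * y)"

definition commutator_space :: "('f::field \<Rightarrow> 'a::{ring,monoid_mult} \<Rightarrow> 'a) \<Rightarrow> 'a set" where
  "commutator_space scale = module.span scale {x * y - y * x | x y. True}"


section \<open>The free algebra\<close>

text \<open>
  \<open>Poly_Mapping\<close> turns the finitely supported functions on an additively written monoid
  into the monoid algebra. The free algebra is the monoid algebra of the free monoid of words,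
  so concatenation of words is written as addition. The letter \<open>i\<close> stands for the variable
  $X_{i+1}$.
\<close>

datatype monomial = Monomial (letters: "nat list")

instantiation monomial :: monoid_add
begin

definition zero_monomial :: monomial where
  "0 = Monomial []"

definition plus_monomial :: "monomial \<Rightarrow> monomial \<Rightarrow> monomial" where
  "u + v = Monomial (letters u @ letters v)"

instance
  by standard (simp_all add: zero_monomial_def plus_monomial_def)

end

type_synonym 'f free_algebra = "monomial \<Rightarrow>\<^sub>0 'f"

definition nc_const :: "'f::field \<Rightarrow> 'f free_algebra" where
  "nc_const c = Poly_Mapping.single 0 c"

definition nc_var :: "nat \<Rightarrow> 'f::field free_algebra" where
  "nc_var i = Poly_Mapping.single (Monomial [i]) 1"

definition nonconstant :: "'f::field free_algebra \<Rightarrow> bool" where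
  "nonconstant f \<longleftrightarrow> f \<notin> range nc_const"

definition nc_eval ::
  "('f::field \<Rightarrow> 'a::{ring,monoid_mult} \<Rightarrow> 'a) \<Rightarrow> (nat \<Rightarrow> 'a) \<Rightarrow> 'f free_algebra \<Rightarrow> 'a" where
  "nc_eval scale a f =
    (\<Sum>w\<in>Poly_Mapping.keys f. scale (Poly_Mapping.lookup f w) (prod_list (map a (letters w))))"

text \<open>
  The value set $f(A)$. Substituting an infinite sequence is the same as substituting a tuple
  for the finitely many variables that occur in \<open>f\<close>, see \<open>nc_eval_cong\<close> below.
\<close>

definition nc_image ::
  "('f::field \<Rightarrow> 'a::{ring,monoid_mult} \<Rightarrow> 'a) \<Rightarrow> 'f free_algebra \<Rightarrow> 'a set" where
  "nc_image scale f = {nc_eval scale a f | a. True}"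

lemma nc_eval_cong:
  assumes "\<And>w i. w \<in> Poly_Mapping.keys f \<Longrightarrow> i \<in> set (letters w) \<Longrightarrow> a i = b i"
  shows "nc_eval scale a f = nc_eval scale b f"
  unfolding nc_eval_def using assms by (auto intro!: sum.cong arg_cong[where f = "scale _"]
      arg_cong[where f = prod_list])


section \<open>Evaluation is the homomorphism given by the universal property\<close>

lemma update_eq_single_add:
  assumes "w \<notin> Poly_Mapping.keys f"
  shows "Poly_Mapping.update w c f = Poly_Mapping.single w c + f"
  using assms
  by (intro poly_mapping_eqI) (auto simp: lookup_update lookup_add lookup_single when_def in_keys_iff)

context unital_algebra
begin

lemma nc_eval_superset:
  assumes "finite S" "Poly_Mapping.keys f \<subseteq> S"
  shows "nc_eval scale a f =
    (\<Sum>w\<in>S. scale (Poly_Mapping.lookup f w) (prod_list (map a (letters w))))"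
  unfolding nc_eval_def
  by (rule sum.mono_neutral_left) (use assms in \<open>auto simp: in_keys_iff\<close>)

lemma nc_eval_single:
  "nc_eval scale a (Poly_Mapping.single w c) = scale c (prod_list (map a (letters w)))"
  by (subst nc_eval_superset[of "{w}"]) auto

lemma nc_eval_const: "nc_eval scale a (nc_const c) = scale c 1"
  by (simp add: nc_const_def nc_eval_single zero_monomial_def)

lemma nc_eval_var: "nc_eval scale a (nc_var i) = a i"
  by (simp add: nc_var_def nc_eval_single)

lemma nc_eval_add: "nc_eval scale a (f + g) = nc_eval scale a f + nc_eval scale a g"
proof -
  let ?S = "Poly_Mapping.keys f \<union> Poly_Mapping.keys g"
  have "Poly_Mapping.keys (f + g) \<subseteq> ?S"
    by (rule Poly_Mapping.keys_add)
  then show ?thesis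
    by (simp add: nc_eval_superset[of ?S] lookup_add scale_left_distrib sum.distrib)
qed

lemma nc_eval_mult: "nc_eval scale a (f * g) = nc_eval scale a f * nc_eval scale a g"
proof -
  have zero: "nc_eval scale a 0 = 0"
    by (simp add: nc_eval_def)
  have single: "nc_eval scale a (Poly_Mapping.single u c * Poly_Mapping.single v d) =
      nc_eval scale a (Poly_Mapping.single u c) * nc_eval scale a (Poly_Mapping.single v d)"
    for u v c d
    by (simp add: mult_single nc_eval_single plus_monomial_def scale_mult_left scale_mult_right)
  have right: "nc_eval scale a (Poly_Mapping.single u c * g) =
      nc_eval scale a (Poly_Mapping.single u c) * nc_eval scale a g" for u c
    by (induction g rule: update_induct)
      (simp_all add: zero update_eq_single_add distrib_left nc_eval_add single)
  show ?thesis
    by (induction f rule: update_induct)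
      (simp_all add: zero update_eq_single_add distrib_right nc_eval_add right)
qed

end

end

theory Submission
  imports Defs
begin

text \<open>
  Multilinearizing a homogeneous part of top degree of \<open>f\<close> gives a nonzero multilinear \<open>h\<close> whose
  values lie in \<open>span f(A)\<close>; the span \<open>L\<close> of these values is a Lie ideal. By an
  argument of Herstein, the ideal \<open>J\<close> generated by \<open>[L, L]\<close> satisfies \<open>[J, A] \<subseteq> L\<close>, so it suffices
  that \<open>J = A\<close>. Otherwise \<open>J\<close> lies in a maximal left ideal \<open>M\<close>, and \<open>[h(x), h(y)]\<close> annihilates the
  simple module \<open>A/M\<close>. Let \<open>K\<close> be a maximal commutative subring of its endomorphism ring. Then \<open>K\<close> is a
  field, and by density the operators generated by \<open>A\<close> and \<open>K\<close> satisfy no multilinear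
  identity unless \<open>A/M\<close> has finite dimension over \<open>K\<close>. In that case, the trace of the action of
  \<open>1 \<in> [A, A]\<close> on \<open>A/M\<close> is zero, but it is also the dimension, which contradicts characteristic \<open>0\<close>.
\<close>

section \<open>The simple module of a maximal left ideal\<close>

text \<open>The module A/M is never formed: its elements are represented in A, and equality is a
  difference in \<open>M\<close>. By \<open>maximal\<close>, every element outside \<open>M\<close>
  generates A/M.\<close>

locale maximal_left_ideal =
  fixes M :: "'a::{ring,monoid_mult} set"
  assumes zero_mem: "0 \<in> M"
    and add_mem: "x \<in> M \<Longrightarrow> y \<in> M \<Longrightarrow> x + y \<in> M"
    and lmult_mem: "x \<in> M \<Longrightarrow> a * x \<in> M"
    and one_notin: "1 \<notin> M"
    and maximal: "x \<notin> M \<Longrightarrow> \<exists>a. a * x - 1 \<in> M"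
begin

lemma uminus_mem: "x \<in> M \<Longrightarrow> - x \<in> M"
  using lmult_mem[of x "- 1"] by simp

lemma diff_mem: "x \<in> M \<Longrightarrow> y \<in> M \<Longrightarrow> x - y \<in> M"
  using add_mem[of x "- y"] uminus_mem[of y] by simp

lemma sum_mem: "(\<And>i. i \<in> I \<Longrightarrow> g i \<in> M) \<Longrightarrow> sum g I \<in> M"
  by (induction I rule: infinite_finite_induct) (auto simp: zero_mem add_mem)

lemma diff_mem_sym: "x - y \<in> M \<Longrightarrow> y - x \<in> M"
  using uminus_mem[of "x - y"] by simp

lemma diff_mem_trans: "x - y \<in> M \<Longrightarrow> y - z \<in> M \<Longrightarrow> x - z \<in> M"
  using add_mem[of "x - y" "y - z"] by simp

lemma mem_if_diff_mem: "x - y \<in> M \<Longrightarrow> y \<in> M \<Longrightarrow> x \<in> M"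
  using add_mem[of "x - y" y] by simp

lemma sum_diff_mem: "(\<And>i. i \<in> I \<Longrightarrow> g i - h i \<in> M) \<Longrightarrow> sum g I - sum h I \<in> M"
  using sum_mem[of I "\<lambda>i. g i - h i"] by (simp add: sum_subtractf)

end

text \<open>
  The set \<open>B\<close> lies in the idealizer \<open>{b. M b \<subseteq> M}\<close>, whose quotient by \<open>M\<close> is the opposite of the
  endomorphism ring of the simple module \<open>A/M\<close>, and \<open>B/M\<close> is a maximal commutative
  subring of it. Hence \<open>B/M\<close> is a field, which acts on \<open>A/M\<close> from the right.
\<close>

locale maximal_commuting_set = maximal_left_ideal M for M :: "'a::{ring,monoid_mult} set" +
  fixes B :: "'a set"
  assumes rmult_mem: "x \<in> M \<Longrightarrow> b \<in> B \<Longrightarrow> x * b \<in> M"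
    and commute: "b \<in> B \<Longrightarrow> c \<in> B \<Longrightarrow> b * c - c * b \<in> M"
    and memB: "(\<And>m. m \<in> M \<Longrightarrow> m * x \<in> M) \<Longrightarrow> (\<And>b. b \<in> B \<Longrightarrow> x * b - b * x \<in> M) \<Longrightarrow> x \<in> B"
begin

lemma zeroB: "0 \<in> B"
  by (rule memB) (auto simp: zero_mem)

lemma oneB: "1 \<in> B"
  by (rule memB) (auto simp: zero_mem)

lemma addB:
  assumes "b \<in> B" "c \<in> B"
  shows "b + c \<in> B"
proof (rule memB)
  show "m * (b + c) \<in> M" if "m \<in> M" for m
    using that assms by (simp add: distrib_left add_mem rmult_mem)
  show "(b + c) * d - d * (b + c) \<in> M" if "d \<in> B" for d
    using add_mem[OF commute[OF assms(1) that] commute[OF assms(2) that]] by (simp add: algebra_simps)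
qed

lemma multB:
  assumes "b \<in> B" "c \<in> B"
  shows "b * c \<in> B"
proof (rule memB)
  show "m * (b * c) \<in> M" if "m \<in> M" for m
    using that assms by (simp add: mult.assoc[symmetric] rmult_mem)
  show "(b * c) * d - d * (b * c) \<in> M" if "d \<in> B" for d
  proof -
    have "(b * c) * d - d * (b * c) = b * (c * d - d * c) + (b * d - d * b) * c"
      by (simp add: algebra_simps)
    then show ?thesis
      using assms that by (simp add: add_mem lmult_mem rmult_mem commute)
  qed
qed

lemma uminusB: "b \<in> B \<Longrightarrow> - b \<in> B"
proof (rule memB)
  fix m assume "b \<in> B" "m \<in> M"
  then show "m * - b \<in> M"
    using uminus_mem[OF rmult_mem] by simp
next
  fix d assume "b \<in> B" "d \<in> B"
  then show "- b * d - d * - b \<in> M"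
    using commute[of d b] by (simp add: algebra_simps)
qed

lemma diffB: "b \<in> B \<Longrightarrow> c \<in> B \<Longrightarrow> b - c \<in> B"
  using addB[of b "- c"] uminusB by simp

lemma sumB: "(\<And>i. i \<in> I \<Longrightarrow> g i \<in> B) \<Longrightarrow> sum g I \<in> B"
  by (induction I rule: infinite_finite_induct) (auto simp: zeroB addB)

lemma lmult_diff_mem: "x - y \<in> M \<Longrightarrow> a * x - a * y \<in> M"
  using lmult_mem[of "x - y" a] by (simp add: algebra_simps)

text \<open>Injectivity half of Schur's lemma: if \<open>x\<close> were outside \<open>M\<close>, a
  left inverse of \<open>x\<close> modulo \<open>M\<close> applied to \<open>x * b\<close> would put
  \<open>b\<close> into \<open>M\<close>.\<close>

lemma cancelB:
  assumes b: "b \<in> B" "b \<notin> M" and xb: "x * b \<in> M"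
  shows "x \<in> M"
proof (rule ccontr)
  assume "x \<notin> M"
  then obtain a where "a * x - 1 \<in> M"
    using maximal by blast
  then have "(a * x - 1) * b \<in> M"
    using b rmult_mem by blast
  moreover have "a * (x * b) \<in> M"
    using xb by (rule lmult_mem)
  ultimately have "a * (x * b) - (a * x - 1) * b \<in> M"
    by (rule diff_mem[rotated])
  then show False
    using b by (simp add: algebra_simps)
qed

text \<open>The other half of Schur's lemma: \<open>maximal\<close> provides a left inverse
  \<open>c\<close> of \<open>b\<close> modulo \<open>M\<close>, and by \<open>cancelB\<close> the
  conditions for \<open>c \<in> B\<close> may be checked after right multiplication by
  \<open>b\<close>.\<close>

lemma inverseB:
  assumes b: "b \<in> B" "b \<notin> M"
  obtains c where "c \<in> B" "b * c - 1 \<in> M"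
proof -
  obtain c where c: "c * b - 1 \<in> M"
    using maximal b by blast
  have cB: "c \<in> B"
  proof (rule memB)
    fix m assume m: "m \<in> M"
    have "(m * c) * b = m * (c * b - 1) + m"
      by (simp add: algebra_simps)
    then have "(m * c) * b \<in> M"
      using m c by (simp add: add_mem lmult_mem)
    then show "m * c \<in> M"
      using b cancelB by blast
  next
    fix d assume d: "d \<in> B"
    have "(c * d - d * c) * b = c * (d * b - b * d) + (c * b - 1) * d - d * (c * b - 1)"
      by (simp add: algebra_simps)
    then have "(c * d - d * c) * b \<in> M"
      using b c d by (simp add: add_mem diff_mem lmult_mem rmult_mem commute)
    then show "c * d - d * c \<in> M"
      using b cancelB by blast
  qed
  moreover have "b * c - 1 \<in> M"
    using diff_mem_trans[OF commute[OF b(1) cB] c] .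
  ultimately show ?thesis
    using that by blast
qed

section \<open>Operators generated by A and B\<close>

inductive_set ops :: "('a \<Rightarrow> 'a) set" where
  ops_mult: "b \<in> B \<Longrightarrow> (\<lambda>x. a * x * b) \<in> ops"
| ops_add: "S \<in> ops \<Longrightarrow> T \<in> ops \<Longrightarrow> (\<lambda>x. S x + T x) \<in> ops"

lemma ops_lmult: "(*) a \<in> ops"
  using ops_mult[OF oneB, of a] by simp

lemma ops_add_arg: "T \<in> ops \<Longrightarrow> T (x + y) = T x + T y"
  by (induction rule: ops.induct) (simp_all add: algebra_simps)

lemma ops_zero: "T \<in> ops \<Longrightarrow> T 0 = 0"
  by (induction rule: ops.induct) simp_all

lemma ops_diff_arg: "T \<in> ops \<Longrightarrow> T (x - y) = T x - T y"
  by (induction rule: ops.induct) (simp_all add: algebra_simps)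

lemma ops_sum: "T \<in> ops \<Longrightarrow> T (sum g I) = (\<Sum>i\<in>I. T (g i))"
  by (induction I rule: infinite_finite_induct) (simp_all add: ops_zero ops_add_arg)

lemma ops_mem: "T \<in> ops \<Longrightarrow> x \<in> M \<Longrightarrow> T x \<in> M"
  by (induction rule: ops.induct) (simp_all add: add_mem lmult_mem rmult_mem)

lemma ops_cong: "T \<in> ops \<Longrightarrow> x - y \<in> M \<Longrightarrow> T x - T y \<in> M"
  using ops_mem[of T "x - y"] by (simp add: ops_diff_arg)

text \<open>Linearity over K = B/M. It holds only modulo \<open>M\<close>, because elements of
  \<open>B\<close> commute only modulo \<open>M\<close>.\<close>

lemma ops_rmult_arg: "T \<in> ops \<Longrightarrow> c \<in> B \<Longrightarrow> T (x * c) - T x * c \<in> M"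
proof (induction rule: ops.induct)
  case (ops_mult b a)
  have "a * (x * c) * b - a * x * b * c = (a * x) * (c * b - b * c)"
    by (simp add: algebra_simps)
  then show ?case
    using ops_mult by (simp add: lmult_mem commute)
next
  case (ops_add S T)
  then show ?case
    using add_mem[of "S (x * c) - S x * c" "T (x * c) - T x * c"] by (simp add: algebra_simps)
qed

lemma ops_lcomp: "T \<in> ops \<Longrightarrow> (\<lambda>x. a * T x) \<in> ops"
proof (induction rule: ops.induct)
  case (ops_mult b c)
  then show ?case
    using ops.ops_mult[of b "a * c"] by (simp add: mult.assoc)
next
  case (ops_add S T)
  then show ?case
    using ops.ops_add by (simp add: distrib_left)
qed

lemma ops_rcomp: "T \<in> ops \<Longrightarrow> c \<in> B \<Longrightarrow> (\<lambda>x. T x * c) \<in> ops"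
proof (induction rule: ops.induct)
  case (ops_mult b a)
  then show ?case
    using ops.ops_mult[of "b * c" a] multB by (simp add: mult.assoc)
next
  case (ops_add S T)
  then show ?case
    using ops.ops_add by (simp add: distrib_right)
qed

lemma ops_diff: "S \<in> ops \<Longrightarrow> T \<in> ops \<Longrightarrow> (\<lambda>x. S x - T x) \<in> ops"
  using ops_add[of S "\<lambda>x. (- 1) * T x"] ops_lcomp[of T "- 1"] by simp

section \<open>Spans over the field B/M and density\<close>

text \<open>The preimage in A of a K-subspace of A/M, so it contains \<open>M\<close>, and the empty
  span is \<open>M\<close>.\<close>

definition right_span :: "nat \<Rightarrow> (nat \<Rightarrow> 'a) \<Rightarrow> 'a set" where
  "right_span k v = {x. \<exists>b. (\<forall>i<k. b i \<in> B) \<and> x - (\<Sum>i<k. v i * b i) \<in> M}"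

lemma right_spanI: "(\<And>i. i < k \<Longrightarrow> b i \<in> B) \<Longrightarrow> x - (\<Sum>i<k. v i * b i) \<in> M \<Longrightarrow> x \<in> right_span k v"
  unfolding right_span_def by blast

lemma right_spanE:
  assumes "x \<in> right_span k v"
  obtains b where "\<forall>i<k. b i \<in> B" "x - (\<Sum>i<k. v i * b i) \<in> M"
  using assms unfolding right_span_def by blast

lemma right_span_0: "right_span 0 v = M"
  by (simp add: right_span_def)

lemma right_span_SucI:
  assumes "x - v k * c \<in> right_span k v" "c \<in> B"
  shows "x \<in> right_span (Suc k) v"
proof -
  obtain b where b: "\<forall>i<k. b i \<in> B" "x - v k * c - (\<Sum>i<k. v i * b i) \<in> M"
    using assms(1) by (rule right_spanE)
  have "(\<Sum>i<k. v i * (b(k := c)) i) = (\<Sum>i<k. v i * b i)"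
    by (rule sum.cong) auto
  then show ?thesis
    using b assms(2) by (intro right_spanI[of _ "b(k := c)"]) (auto simp: algebra_simps less_Suc_eq)
qed

lemma right_span_Suc_mono: "x \<in> right_span k v \<Longrightarrow> x \<in> right_span (Suc k) v"
  by (rule right_span_SucI[of _ _ _ 0]) (auto simp: zeroB)

lemma right_span_cong: "(\<And>i. i < k \<Longrightarrow> v i = w i) \<Longrightarrow> right_span k v = right_span k w"
proof -
  assume "\<And>i. i < k \<Longrightarrow> v i = w i"
  then have "(\<Sum>i<k. v i * b i) = (\<Sum>i<k. w i * b i)" for b
    by (intro sum.cong) auto
  then show ?thesis
    by (simp add: right_span_def)
qed

lemma ops_spn_mem:
  assumes T: "T \<in> ops" and kill: "\<And>i. i < k \<Longrightarrow> T (v i) \<in> M" and x: "x \<in> right_span k v"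
  shows "T x \<in> M"
proof -
  obtain b where b: "\<forall>i<k. b i \<in> B" "x - (\<Sum>i<k. v i * b i) \<in> M"
    using x by (rule right_spanE)
  have "T (v i * b i) \<in> M" if "i < k" for i
    using mem_if_diff_mem[OF ops_rmult_arg[OF T] rmult_mem[OF kill]] b(1) that by blast
  then have "T (\<Sum>i<k. v i * b i) \<in> M"
    unfolding ops_sum[OF T] by (intro sum_mem) simp
  then show ?thesis
    using mem_if_diff_mem[OF ops_cong[OF T b(2)]] by blast
qed

text \<open>
  Jacobson density for \<open>A/M\<close> over the field \<open>B/M\<close>. In the induction step, if every operator
  that kills \<open>v 0, \<dots>, v k\<close> also killed \<open>u\<close>, then \<open>T (v k) \<mapsto> T u\<close> would be an endomorphism
  commuting with \<open>B\<close>, that is, right multiplication by some \<open>b \<in> B\<close>; then no operator that kills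
  \<open>v 0, \<dots>, v (k - 1)\<close> would detect \<open>u - v k * b\<close>.
\<close>

lemma density_nonzero:
  assumes "u \<notin> right_span k v"
  shows "\<exists>T\<in>ops. (\<forall>i<k. T (v i) \<in> M) \<and> T u \<notin> M"
  using assms
proof (induction k arbitrary: u)
  case 0
  then show ?case
    using ops_lmult[of 1] by (intro bexI[of _ "(*) 1"]) (auto simp: right_span_0)
next
  case (Suc k)
  show ?case
  proof (cases "v k \<in> right_span k v")
    case True
    have "u \<notin> right_span k v"
      using Suc.prems right_span_Suc_mono by blast
    then obtain T where "T \<in> ops" "\<forall>i<k. T (v i) \<in> M" "T u \<notin> M"
      using Suc.IH by blast
    then show ?thesis
      using ops_spn_mem[OF _ _ True] by (intro bexI[of _ T]) (auto simp: less_Suc_eq)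
  next
    case False
    then obtain T1 where T1: "T1 \<in> ops" "\<forall>i<k. T1 (v i) \<in> M" "T1 (v k) \<notin> M"
      using Suc.IH by blast
    then obtain a where a: "a * T1 (v k) - 1 \<in> M"
      using maximal by blast
    define T0 where "T0 = (\<lambda>x. a * T1 x)"
    have T0: "T0 \<in> ops" "\<And>i. i < k \<Longrightarrow> T0 (v i) \<in> M" "T0 (v k) - 1 \<in> M"
      using T1 a by (auto simp: T0_def ops_lcomp lmult_mem)
    show ?thesis
    proof (rule ccontr)
      assume "\<not> ?thesis"
      then have kill: "T u \<in> M" if "T \<in> ops" "\<And>i. i < k \<Longrightarrow> T (v i) \<in> M" "T (v k) \<in> M" for T
        using that by (metis less_Suc_eq)
      define b where "b = T0 u"
      have b: "b \<in> B"
      proof (rule memB)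
        fix m assume m: "m \<in> M"
        have "m * T0 (v k) = m * (T0 (v k) - 1) + m"
          by (simp add: algebra_simps)
        then have "m * T0 (v k) \<in> M"
          using m T0 by (simp add: add_mem lmult_mem)
        then show "m * b \<in> M"
          unfolding b_def using kill[of "\<lambda>x. m * T0 x"] T0 by (simp add: ops_lcomp lmult_mem)
      next
        fix c assume c: "c \<in> B"
        have "T0 (v k) * c - c * T0 (v k) = (T0 (v k) - 1) * c - c * (T0 (v k) - 1)"
          by (simp add: algebra_simps)
        then have "T0 (v k) * c - c * T0 (v k) \<in> M"
          using c T0 by (simp add: diff_mem lmult_mem rmult_mem)
        then show "b * c - c * b \<in> M"
          unfolding b_def using c T0 kill[of "\<lambda>x. T0 x * c - c * T0 x"]
          by (simp add: ops_diff ops_lcomp ops_rcomp diff_mem lmult_mem rmult_mem)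
      qed
      have "u - v k * b \<notin> right_span k v"
        using right_span_SucI[OF _ b] Suc.prems by blast
      then obtain T where T: "T \<in> ops" "\<forall>i<k. T (v i) \<in> M" "T (u - v k * b) \<notin> M"
        using Suc.IH by blast
      have "T (v k) - T (v k) * T0 (v k) = - (T (v k) * (T0 (v k) - 1))"
        by (simp add: algebra_simps)
      then have "T (v k) - T (v k) * T0 (v k) \<in> M"
        using T0 by (simp add: uminus_mem lmult_mem)
      then have "T u - T (v k) * b \<in> M"
        unfolding b_def using T T0 kill[of "\<lambda>x. T x - T (v k) * T0 x"]
        by (simp add: ops_diff ops_lcomp diff_mem lmult_mem)
      then have "T u - T (v k * b) \<in> M"
        using diff_mem_trans[OF _ diff_mem_sym[OF ops_rmult_arg[OF T(1) b]]] by blast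
      then show False
        using T by (simp add: ops_diff_arg)
    qed
  qed
qed

text \<open>As A/M is simple, left multiplication moves the nonzero value from
  \<open>density_nonzero\<close> to any \<open>y\<close> and keeps the zeros.\<close>

lemma density:
  assumes "u \<notin> right_span k v"
  shows "\<exists>T\<in>ops. (\<forall>i<k. T (v i) \<in> M) \<and> T u - y \<in> M"
proof -
  obtain T where T: "T \<in> ops" "\<forall>i<k. T (v i) \<in> M" "T u \<notin> M"
    using density_nonzero[OF assms] by blast
  then obtain a where a: "a * T u - 1 \<in> M"
    using maximal by blast
  have "y * a * T u - y = y * (a * T u - 1)"
    by (simp add: algebra_simps)
  then have "y * a * T u - y \<in> M"
    using a by (simp add: lmult_mem)
  then show ?thesis
    using T by (intro bexI[of _ "\<lambda>x. y * a * T x"]) (auto simp: ops_lcomp lmult_mem)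
qed


section \<open>Independence and the trace\<close>

text \<open>Linear independence over K in sequential form, which is what \<open>density\<close> asks
  of each vector relative to its predecessors.\<close>

definition indep :: "nat \<Rightarrow> (nat \<Rightarrow> 'a) \<Rightarrow> bool" where
  "indep k v \<longleftrightarrow> (\<forall>i<k. v i \<notin> right_span i v)"

lemma indep_extend:
  assumes "indep k v" "x \<notin> right_span k v"
  shows "indep (Suc k) (v(k := x))"
proof -
  have "right_span i (v(k := x)) = right_span i v" if "i \<le> k" for i
    using that by (intro right_span_cong) auto
  then show ?thesis
    using assms by (auto simp: indep_def less_Suc_eq)
qed

text \<open>A last coefficient outside \<open>M\<close> could be inverted, which would put
  \<open>v k\<close> into the span of its predecessors. Hence its term drops out and induction
  applies.\<close>

lemma indep_coeffs:
  assumes "indep k v" "\<forall>i<k. b i \<in> B" "(\<Sum>i<k. v i * b i) \<in> M" "i < k"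
  shows "b i \<in> M"
  using assms
proof (induction k)
  case (Suc k)
  have k: "b k \<in> M"
  proof (rule ccontr)
    assume "b k \<notin> M"
    then obtain c where c: "c \<in> B" "b k * c - 1 \<in> M"
      using inverseB[of "b k"] Suc.prems(2) by blast
    have "v k - (\<Sum>i<k. v i * (- b i * c)) = (\<Sum>i<Suc k. v i * b i) * c - v k * (b k * c - 1)"
      by (simp add: algebra_simps sum_distrib_left sum_distrib_right sum_negf)
    then have "v k - (\<Sum>i<k. v i * (- b i * c)) \<in> M"
      using c Suc.prems by (simp only: diff_mem lmult_mem rmult_mem)
    then have "v k \<in> right_span k v"
      using c Suc.prems by (intro right_spanI[of _ "\<lambda>i. - b i * c"]) (auto simp: multB uminusB simp del: mult_minus_left)
    then show False
      using Suc.prems by (auto simp: indep_def)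
  qed
  then have "v k * b k \<in> M"
    by (rule lmult_mem)
  then have "(\<Sum>i<k. v i * b i) \<in> M"
    using diff_mem[OF Suc.prems(3), of "v k * b k"] by simp
  then show ?case
    using Suc k by (auto simp: indep_def less_Suc_eq)
qed simp

text \<open>
  The hypothesis \<open>one\<close> encodes that \<open>1\<close> is a sum of commutators without a choice of the summands.
\<close>

lemma trace_of_one_mem:
  fixes k :: nat
  assumes indep: "indep k v" and spanning: "\<And>x. x \<in> right_span k v"
    and one: "\<And>H :: 'a \<Rightarrow> 'a. (\<And>x y. H (x + y) - (H x + H y) \<in> M) \<Longrightarrow> (\<And>x y. H (x * y - y * x) \<in> M) \<Longrightarrow> H 1 \<in> M"
  shows "(\<Sum>i<k. 1) \<in> M"
proof -
  have "\<exists>r. (\<forall>i<k. r i \<in> B) \<and> x * v j - (\<Sum>i<k. v i * r i) \<in> M" for x j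
    using spanning[of "x * v j"] by (auto simp: right_span_def)
  then obtain r' where r': "\<And>x j. (\<forall>i<k. r' x j i \<in> B) \<and> x * v j - (\<Sum>i<k. v i * r' x j i) \<in> M"
    by metis
  \<comment> \<open>\<open>r x\<close> is the matrix of left multiplication by \<open>x\<close> on
    A/M in the basis \<open>v\<close>, with column index \<open>j\<close>.\<close>
  define r where "r x i j = r' x j i" for x i j
  have rB: "\<And>x i j. i < k \<Longrightarrow> r x i j \<in> B"
    and r: "\<And>x j. x * v j - (\<Sum>i<k. v i * r x i j) \<in> M"
    using r' by (auto simp: r_def)
  \<comment> \<open>The entries were chosen arbitrarily but are determined modulo \<open>M\<close>.
    Hence \<open>r\<close> respects sums, differences and products modulo \<open>M\<close>.\<close>
  have unique: "r x i j - b i \<in> M"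
    if "i < k" "\<forall>i<k. b i \<in> B" "x * v j - (\<Sum>i<k. v i * b i) \<in> M" for x i j b
  proof -
    have "(\<Sum>i<k. v i * b i) - (\<Sum>i<k. v i * r x i j) \<in> M"
      using diff_mem_trans[OF diff_mem_sym[OF that(3)] r] .
    then have "(\<Sum>i<k. v i * (b i - r x i j)) \<in> M"
      by (simp add: right_diff_distrib sum_subtractf)
    then have "b i - r x i j \<in> M"
      using indep_coeffs[OF indep, of "\<lambda>i. b i - r x i j"] that rB diffB by blast
    then show ?thesis
      by (rule diff_mem_sym)
  qed
  define tr where "tr x = (\<Sum>i<k. r x i i)" for x
  have add: "r (x + y) i j - (r x i j + r y i j) \<in> M" if "i < k" for x y i j
  proof (rule unique[OF that])
    have "(x + y) * v j - (\<Sum>i<k. v i * (r x i j + r y i j)) =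
        (x * v j - (\<Sum>i<k. v i * r x i j)) + (y * v j - (\<Sum>i<k. v i * r y i j))"
      by (simp add: algebra_simps sum.distrib)
    then show "(x + y) * v j - (\<Sum>i<k. v i * (r x i j + r y i j)) \<in> M"
      using r by (simp only: add_mem)
  qed (simp add: rB addB)
  have diff: "r (x - y) i j - (r x i j - r y i j) \<in> M" if "i < k" for x y i j
  proof (rule unique[OF that])
    have "(x - y) * v j - (\<Sum>i<k. v i * (r x i j - r y i j)) =
        (x * v j - (\<Sum>i<k. v i * r x i j)) - (y * v j - (\<Sum>i<k. v i * r y i j))"
      by (simp add: algebra_simps sum_subtractf)
    then show "(x - y) * v j - (\<Sum>i<k. v i * (r x i j - r y i j)) \<in> M"
      using r by (simp only: diff_mem)
  qed (simp add: rB diffB)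
  have mult: "r (x * y) i j - (\<Sum>l<k. r x i l * r y l j) \<in> M" if "i < k" for x y i j
  proof (rule unique[OF that])
    have "(\<Sum>i<k. v i * (\<Sum>l<k. r x i l * r y l j)) = (\<Sum>l<k. (\<Sum>i<k. v i * r x i l) * r y l j)"
      by (simp add: sum_distrib_left sum_distrib_right mult.assoc) (rule sum.swap)
    then have "x * y * v j - (\<Sum>i<k. v i * (\<Sum>l<k. r x i l * r y l j)) =
        x * (y * v j - (\<Sum>l<k. v l * r y l j)) + (\<Sum>l<k. (x * v l - (\<Sum>i<k. v i * r x i l)) * r y l j)"
      by (simp add: algebra_simps sum_subtractf sum_distrib_left)
    moreover have "(\<Sum>l<k. (x * v l - (\<Sum>i<k. v i * r x i l)) * r y l j) \<in> M"
      using r rB by (intro sum_mem rmult_mem) auto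
    ultimately show "x * y * v j - (\<Sum>i<k. v i * (\<Sum>l<k. r x i l * r y l j)) \<in> M"
      using r by (simp add: add_mem lmult_mem)
  qed (auto intro!: rB sumB multB)
  have tr_mult: "tr (x * y) - (\<Sum>i<k. \<Sum>l<k. r x i l * r y l i) \<in> M" for x y
    unfolding tr_def by (rule sum_diff_mem) (simp add: mult)
  have "tr (x * y - y * x) \<in> M" for x y
  proof -
    \<comment> \<open>The usual proof that a trace vanishes on commutators: the entries lie in
      \<open>B\<close>, so they commute modulo \<open>M\<close>.\<close>
    have "(\<Sum>i<k. \<Sum>l<k. r x i l * r y l i) - (\<Sum>i<k. \<Sum>l<k. r y l i * r x i l) \<in> M"
      by (intro sum_diff_mem commute rB) auto
    moreover have "(\<Sum>i<k. \<Sum>l<k. r y l i * r x i l) = (\<Sum>i<k. \<Sum>l<k. r y i l * r x l i)"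
      by (rule sum.swap)
    ultimately have "(\<Sum>i<k. \<Sum>l<k. r x i l * r y l i) - (\<Sum>i<k. \<Sum>l<k. r y i l * r x l i) \<in> M"
      by simp
    then have "tr (x * y) - tr (y * x) \<in> M"
      by (rule diff_mem_trans[OF diff_mem_trans[OF tr_mult] diff_mem_sym[OF tr_mult]])
    moreover have "tr (x * y - y * x) - (tr (x * y) - tr (y * x)) \<in> M"
      unfolding tr_def sum_subtractf[symmetric] by (rule sum_mem) (simp add: diff)
    ultimately show ?thesis
      by (rule mem_if_diff_mem[rotated])
  qed
  moreover have "tr (x + y) - (tr x + tr y) \<in> M" for x y
    unfolding tr_def sum.distrib[symmetric] by (rule sum_diff_mem) (simp add: add)
  ultimately have "tr 1 \<in> M"
    by (intro one[of tr])
  moreover have "tr 1 - (\<Sum>i<k. 1) \<in> M"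
    unfolding tr_def
  proof (rule sum_diff_mem)
    fix i assume i: "i \<in> {..<k}"
    have "(\<Sum>l<k. v l * (if l = i then 1 else 0)) = v i"
      using i by (simp add: if_distrib[of "\<lambda>x. _ * x"] cong: if_cong)
    then have "r 1 i i - (if i = i then 1 else 0) \<in> M"
      using i by (intro unique) (auto simp: zeroB oneB zero_mem)
    then show "r 1 i i - 1 \<in> M"
      by simp
  qed
  ultimately show ?thesis
    using mem_if_diff_mem diff_mem_sym by blast
qed

section \<open>Multilinear identities for operators\<close>

lemma foldr_ops_rmult:
  assumes "\<And>j. T j \<in> ops" "b \<in> B"
  shows "foldr T us (x * b) - foldr T us x * b \<in> M"
proof (induction us)
  case (Cons u us)
  then show ?case
    using diff_mem_trans[OF ops_cong[OF assms(1) Cons] ops_rmult_arg[OF assms]] by simp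
qed (simp add: zero_mem)

lemma foldr_ops_add: "(\<And>j. T j \<in> ops) \<Longrightarrow> foldr T us (x + y) = foldr T us x + foldr T us y"
  by (induction us) (simp_all add: ops_add_arg)

text \<open>A letter that occurs exactly once isolates a single slot for the operator at
  \<open>j\<close>; this makes the word linear in that operator.\<close>

lemma foldr_upd_split:
  assumes "distinct us" "j \<in> set us"
  obtains us1 us2 where "\<And>S x. foldr (T(j := S)) us x = foldr T us1 (S (foldr T us2 x))"
proof -
  obtain us1 us2 where us: "us = us1 @ j # us2"
    using assms(2) by (meson split_list)
  then have "foldr (T(j := S)) us2 x = foldr T us2 x" "foldr (T(j := S)) us1 x = foldr T us1 x" for S x
    using assms(1) by (auto intro!: foldr_cong)
  then show ?thesis
    using us that[of us1 us2] by simp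
qed

text \<open>
  A multilinear identity of \<open>A\<close> acting on \<open>A/M\<close> passes to the operators in \<open>ops\<close>, because
  right multiplications by elements of \<open>B\<close> commute with them modulo \<open>M\<close>.
\<close>

lemma multilinear_identity_ops:
  fixes c :: "'i \<Rightarrow> 'a" and \<phi> :: "'i \<Rightarrow> nat list"
  assumes \<phi>: "\<And>i. i \<in> I \<Longrightarrow> distinct (\<phi> i) \<and> set (\<phi> i) = V" and "finite V"
    and identity: "\<And>z s. (\<Sum>i\<in>I. c i * (prod_list (map z (\<phi> i)) * s)) \<in> M"
    and T: "\<And>j. T j \<in> ops"
  shows "(\<Sum>i\<in>I. c i * foldr T (\<phi> i) s) \<in> M"
proof -
  \<comment> \<open>Induction on a set \<open>W\<close> of letters outside which all operators are
    left multiplications. A new letter \<open>j\<close> is treated by rule induction on its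
    operator.\<close>
  have "(\<Sum>i\<in>I. c i * foldr T (\<phi> i) s) \<in> M"
    if "finite W" "W \<subseteq> V" "\<And>j. T j \<in> ops" "\<And>j. j \<notin> W \<Longrightarrow> \<exists>a. T j = (*) a" for T W s
    using that
  proof (induction W arbitrary: T s)
    case empty
    then obtain z where z: "T = (\<lambda>j. (*) (z j))"
      by (metis empty_iff)
    have "foldr T us s = prod_list (map z us) * s" for us
      by (induction us) (simp_all add: z mult.assoc)
    then show ?case
      using identity by simp
  next
    case (insert j W)
    have "(\<Sum>i\<in>I. c i * foldr (T(j := S)) (\<phi> i) s) \<in> M" if "S \<in> ops" for S s
      using that
    proof (induction arbitrary: s rule: ops.induct)
      case (ops_mult b a)
      have "(\<Sum>i\<in>I. c i * foldr (T(j := (*) a)) (\<phi> i) s) \<in> M"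
        by (rule insert.IH) (use insert.prems ops_lmult in \<open>auto simp: fun_upd_def\<close>)
      then have *: "(\<Sum>i\<in>I. c i * foldr (T(j := (*) a)) (\<phi> i) s) * b \<in> M"
        using ops_mult by (rule rmult_mem)
      have "(\<Sum>i\<in>I. c i * foldr (T(j := \<lambda>x. a * x * b)) (\<phi> i) s) -
          (\<Sum>i\<in>I. c i * (foldr (T(j := (*) a)) (\<phi> i) s * b)) \<in> M"
      proof (intro sum_diff_mem lmult_diff_mem)
        fix i assume "i \<in> I"
        then have "distinct (\<phi> i)" "j \<in> set (\<phi> i)"
          using \<phi> insert.prems by auto
        then obtain us1 us2 where split:
          "\<And>S x. foldr (T(j := S)) (\<phi> i) x = foldr T us1 (S (foldr T us2 x))"
          using foldr_upd_split by metis
        show "foldr (T(j := \<lambda>x. a * x * b)) (\<phi> i) s - foldr (T(j := (*) a)) (\<phi> i) s * b \<in> M"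
          unfolding split using insert.prems ops_mult by (intro foldr_ops_rmult) auto
      qed
      moreover have "(\<Sum>i\<in>I. c i * (foldr (T(j := (*) a)) (\<phi> i) s * b)) \<in> M"
        using * by (simp add: sum_distrib_right mult.assoc)
      ultimately show ?case
        by (rule mem_if_diff_mem)
    next
      case (ops_add S1 S2)
      have "foldr (T(j := \<lambda>x. S1 x + S2 x)) (\<phi> i) s =
          foldr (T(j := S1)) (\<phi> i) s + foldr (T(j := S2)) (\<phi> i) s" if "i \<in> I" for i
      proof -
        have "distinct (\<phi> i)" "j \<in> set (\<phi> i)"
          using that \<phi> insert.prems by auto
        then obtain us1 us2 where split:
          "\<And>S x. foldr (T(j := S)) (\<phi> i) x = foldr T us1 (S (foldr T us2 x))"
          using foldr_upd_split by metis
        show ?thesis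
          unfolding split using insert.prems by (simp add: foldr_ops_add)
      qed
      then have "(\<Sum>i\<in>I. c i * foldr (T(j := \<lambda>x. S1 x + S2 x)) (\<phi> i) s) =
          (\<Sum>i\<in>I. c i * foldr (T(j := S1)) (\<phi> i) s) + (\<Sum>i\<in>I. c i * foldr (T(j := S2)) (\<phi> i) s)"
        by (simp add: distrib_left sum.distrib)
      then show ?case
        using add_mem[OF ops_add.IH(1)[of s] ops_add.IH(2)[of s]] by (simp only:)
    qed
    from this[of "T j"] show ?case
      using insert.prems by simp
  qed
  \<comment> \<open>Letters outside \<open>V\<close> occur in no word, so their operators may be
    replaced by the identity, a left multiplication.\<close>
  from this[of V "\<lambda>j. if j \<in> V then T j else (*) 1"]
  have "(\<Sum>i\<in>I. c i * foldr (\<lambda>j. if j \<in> V then T j else (*) 1) (\<phi> i) s) \<in> M"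
    by this (use \<open>finite V\<close> in \<open>auto simp: T ops_lmult\<close>)
  moreover have "(\<Sum>i\<in>I. c i * foldr (\<lambda>j. if j \<in> V then T j else (*) 1) (\<phi> i) s) =
      (\<Sum>i\<in>I. c i * foldr T (\<phi> i) s)"
    using \<phi> by (intro sum.cong refl arg_cong[of _ _ "\<lambda>x. _ * x"] foldr_cong) auto
  ultimately show ?thesis
    by simp
qed

text \<open>
  The operators form a staircase: \<open>T j\<close> sends \<open>v j\<close> to \<open>v (j + 1)\<close> and kills \<open>v i\<close> for \<open>i < j\<close>.
  Applied to \<open>v 0\<close>, only the word \<open>rev [0..<m]\<close> survives, as \<open>foldr\<close> applies the last letter first.
\<close>

lemma multilinear_identity_coeff:
  fixes c :: "'i \<Rightarrow> 'a" and \<phi> :: "'i \<Rightarrow> nat list"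
  assumes "finite I" "i0 \<in> I"
    and \<phi>: "\<And>i. i \<in> I \<Longrightarrow> distinct (\<phi> i) \<and> set (\<phi> i) = {..<m}"
    and \<phi>_i0: "\<And>i. i \<in> I \<Longrightarrow> \<phi> i = rev [0..<m] \<longleftrightarrow> i = i0"
    and identity: "\<And>z s. (\<Sum>i\<in>I. c i * (prod_list (map z (\<phi> i)) * s)) \<in> M"
    and indep: "indep (Suc m) v"
  shows "c i0 * v m \<in> M"
proof -
  \<comment> \<open>For \<open>j \<ge> m\<close> the zero operator serves as a default.\<close>
  have "\<exists>T\<in>ops. (\<forall>i<j. T (v i) \<in> M) \<and> (j < m \<longrightarrow> T (v j) - v (Suc j) \<in> M)" for j
  proof (cases "j < m")
    case True
    then show ?thesis
      using density[of "v j" j v] indep by (auto simp: indep_def)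
  next
    case False
    show ?thesis
      using False ops_lmult[of 0] by (intro bexI[of _ "(*) 0"]) (auto simp: zero_mem)
  qed
  then obtain T where T: "\<And>j. T j \<in> ops" "\<And>j i. i < j \<Longrightarrow> T j (v i) \<in> M"
    "\<And>j. j < m \<Longrightarrow> T j (v j) - v (Suc j) \<in> M"
    by metis
  \<comment> \<open>After the letters below \<open>n\<close> have led to \<open>v n\<close>, the
    next letter \<open>j\<close> is new, so \<open>j \<ge> n\<close>: \<open>j = n\<close> steps to
    \<open>v (n + 1)\<close>, and \<open>j > n\<close> kills \<open>v n\<close>. A value in
    \<open>M\<close> stays in \<open>M\<close>.\<close>
  have walk: "if us = rev [0..<length us] then foldr T us (v 0) - v (length us) \<in> M
      else foldr T us (v 0) \<in> M"
    if "distinct us" "set us \<subseteq> {..<m}" for us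
    using that
  proof (induction us)
    case (Cons j us)
    show ?case
    proof (cases "us = rev [0..<length us]")
      case False
      then show ?thesis
        using Cons by (auto simp: ops_mem T(1))
    next
      case True
      define n where "n = length us"
      have us: "us = rev [0..<n]"
        using True by (simp add: n_def)
      then have set_us: "set us = {0..<n}"
        by simp
      have IH: "foldr T us (v 0) - v n \<in> M"
        using Cons True by (simp add: n_def)
      have *: "T j (foldr T us (v 0)) - T j (v n) \<in> M"
        using T(1) IH by (rule ops_cong)
      show ?thesis
      proof (cases "j = n")
        case True
        have "n < m"
          using True Cons.prems by simp
        then have "T j (foldr T us (v 0)) - v (Suc n) \<in> M"
          using diff_mem_trans[OF *] T(3) True by simp
        moreover have "j # us = rev [0..<Suc n]"
          using us True by simp
        ultimately show ?thesis
          by (simp add: n_def)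
      next
        case False
        then have "n < j"
          using Cons.prems set_us by auto
        then have "T j (foldr T us (v 0)) \<in> M"
          using mem_if_diff_mem[OF *] T(2) by blast
        then show ?thesis
          using False by (simp add: n_def)
      qed
    qed
  qed (simp add: zero_mem)
  have len: "length (\<phi> i) = m" if "i \<in> I" for i
    using \<phi>[OF that] distinct_card by fastforce
  have "(\<Sum>i\<in>I. c i * foldr T (\<phi> i) (v 0)) \<in> M"
    by (rule multilinear_identity_ops[OF \<phi> _ identity T(1)]) auto
  moreover have "(\<Sum>i\<in>I. c i * foldr T (\<phi> i) (v 0)) - (\<Sum>i\<in>I. if i = i0 then c i * v m else 0) \<in> M"
  proof (rule sum_diff_mem)
    fix i assume i: "i \<in> I"
    then show "c i * foldr T (\<phi> i) (v 0) - (if i = i0 then c i * v m else 0) \<in> M"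
      using walk[of "\<phi> i"] \<phi>[OF i] \<phi>_i0[OF i] len[OF i] lmult_mem lmult_diff_mem by auto
  qed
  ultimately have "(\<Sum>i\<in>I. if i = i0 then c i * v m else 0) \<in> M"
    using mem_if_diff_mem[OF diff_mem_sym] by blast
  then show ?thesis
    using assms(1,2) by simp
qed

end

section \<open>Existence of maximal left ideals and maximal commuting sets\<close>

lemma ex_maximal_left_ideal:
  fixes J :: "'a::{ring,monoid_mult} set"
  assumes "0 \<in> J" "\<And>x y. x \<in> J \<Longrightarrow> y \<in> J \<Longrightarrow> x + y \<in> J" "\<And>a x. x \<in> J \<Longrightarrow> a * x \<in> J" "1 \<notin> J"
  obtains M where "maximal_left_ideal M" "J \<subseteq> M"
proof -
  define \<I> where "\<I> = {I. J \<subseteq> I \<and> (\<forall>x\<in>I. \<forall>y\<in>I. x + y \<in> I) \<and> (\<forall>a. \<forall>x\<in>I. a * x \<in> I) \<and> 1 \<notin> I}"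
  have "\<exists>M\<in>\<I>. \<forall>I\<in>\<I>. M \<subseteq> I \<longrightarrow> I = M"
  proof (rule subset_Zorn_nonempty)
    have "J \<in> \<I>"
      using assms by (simp add: \<I>_def)
    then show "\<I> \<noteq> {}"
      by blast
    fix \<C> assume "\<C> \<noteq> {}" and chain: "subset.chain \<I> \<C>"
    then have \<C>: "\<And>I. I \<in> \<C> \<Longrightarrow> I \<in> \<I>" "\<And>I I'. I \<in> \<C> \<Longrightarrow> I' \<in> \<C> \<Longrightarrow> I \<subseteq> I' \<or> I' \<subseteq> I"
      by (auto simp: subset_chain_def)
    have "x + y \<in> \<Union>\<C>" if xy: "x \<in> \<Union>\<C>" "y \<in> \<Union>\<C>" for x y
    proof -
      obtain I I' where I: "I \<in> \<C>" "x \<in> I" "I' \<in> \<C>" "y \<in> I'"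
        using xy by blast
      then obtain K where "K \<in> \<C>" "x \<in> K" "y \<in> K"
        using \<C>(2)[OF I(1,3)] by blast
      then show ?thesis
        using \<C>(1) unfolding \<I>_def by blast
    qed
    then show "\<Union>\<C> \<in> \<I>"
      using \<C>(1) \<open>\<C> \<noteq> {}\<close> unfolding \<I>_def by blast
  qed
  then obtain M where "M \<in> \<I>" and M_max: "\<And>I. I \<in> \<I> \<Longrightarrow> M \<subseteq> I \<Longrightarrow> I = M"
    by blast
  then have M: "J \<subseteq> M" "\<And>x y. x \<in> M \<Longrightarrow> y \<in> M \<Longrightarrow> x + y \<in> M" "\<And>a x. x \<in> M \<Longrightarrow> a * x \<in> M" "1 \<notin> M"
    by (auto simp: \<I>_def)
  have "\<exists>a. a * x - 1 \<in> M" if x: "x \<notin> M" for x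
  proof -
    \<comment> \<open>The left ideal A x + M properly contains \<open>M\<close>, so by maximality it
      must contain 1.\<close>
    define I where "I = {a * x + m | a m. m \<in> M}"
    have "M \<subseteq> I"
    proof
      fix m assume "m \<in> M"
      then have "0 * x + m \<in> I"
        unfolding I_def by blast
      then show "m \<in> I"
        by simp
    qed
    moreover have "1 * x + 0 \<in> I"
      unfolding I_def using M(1) assms(1) by blast
    ultimately have "I \<notin> \<I>"
      using M_max x by auto
    moreover have "y + y' \<in> I" if yy': "y \<in> I" "y' \<in> I" for y y'
    proof -
      obtain a m a' m' where "y = a * x + m" "y' = a' * x + m'" "m \<in> M" "m' \<in> M"
        using yy' unfolding I_def by blast
      then have "y + y' = (a + a') * x + (m + m')" "m + m' \<in> M"
        using M(2) by (auto simp: algebra_simps)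
      then show ?thesis
        unfolding I_def by blast
    qed
    moreover have "b * y \<in> I" if y: "y \<in> I" for b y
    proof -
      obtain a m where "y = a * x + m" "m \<in> M"
        using y unfolding I_def by blast
      then have "b * y = (b * a) * x + b * m" "b * m \<in> M"
        using M(3) by (auto simp: algebra_simps)
      then show ?thesis
        unfolding I_def by blast
    qed
    ultimately have "1 \<in> I"
      using \<open>M \<subseteq> I\<close> M(1) unfolding \<I>_def by blast
    then obtain a m where "1 = a * x + m" "m \<in> M"
      unfolding I_def by blast
    then have "a * x - 1 = (- 1) * m"
      by (simp add: algebra_simps)
    then show ?thesis
      using M(3) \<open>m \<in> M\<close> by metis
  qed
  then have "maximal_left_ideal M"
    using M assms(1) by unfold_locales auto
  then show ?thesis
    using that M(1) by blast
qed

text \<open>Zorn's lemma is applied to mere commuting subsets of the idealizer. An element as in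
  \<open>memB\<close> can be adjoined, so a maximal subset contains it; the ring structure then
  follows from \<open>memB\<close>.\<close>

lemma (in maximal_left_ideal) ex_maximal_commuting_set:
  obtains B where "maximal_commuting_set M B"
proof -
  define \<B> where "\<B> = {B. \<forall>b\<in>B. (\<forall>m\<in>M. m * b \<in> M) \<and> (\<forall>c\<in>B. b * c - c * b \<in> M)}"
  have "\<exists>B\<in>\<B>. \<forall>X\<in>\<B>. B \<subseteq> X \<longrightarrow> X = B"
  proof (rule subset_Zorn_nonempty)
    show "\<B> \<noteq> {}"
      unfolding \<B>_def by blast
    fix \<C> assume "\<C> \<noteq> {}" and chain: "subset.chain \<B> \<C>"
    then have \<C>: "\<And>I. I \<in> \<C> \<Longrightarrow> I \<in> \<B>" "\<And>I I'. I \<in> \<C> \<Longrightarrow> I' \<in> \<C> \<Longrightarrow> I \<subseteq> I' \<or> I' \<subseteq> I"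
      by (auto simp: subset_chain_def)
    have "b * c - c * b \<in> M" if "b \<in> \<Union>\<C>" "c \<in> \<Union>\<C>" for b c
    proof -
      obtain I I' where I: "I \<in> \<C>" "b \<in> I" "I' \<in> \<C>" "c \<in> I'"
        using \<open>b \<in> \<Union>\<C>\<close> \<open>c \<in> \<Union>\<C>\<close> by blast
      then obtain K where "K \<in> \<C>" "b \<in> K" "c \<in> K"
        using \<C>(2)[OF I(1,3)] by blast
      then show ?thesis
        using \<C>(1) unfolding \<B>_def by blast
    qed
    then show "\<Union>\<C> \<in> \<B>"
      using \<C>(1) unfolding \<B>_def by blast
  qed
  then obtain B where "B \<in> \<B>" and B_max: "\<And>X. X \<in> \<B> \<Longrightarrow> B \<subseteq> X \<Longrightarrow> X = B"
    by blast
  then have B: "\<And>m b. m \<in> M \<Longrightarrow> b \<in> B \<Longrightarrow> m * b \<in> M" "\<And>b c. b \<in> B \<Longrightarrow> c \<in> B \<Longrightarrow> b * c - c * b \<in> M"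
    by (auto simp: \<B>_def)
  have maxB: "x \<in> B" if x: "\<And>m. m \<in> M \<Longrightarrow> m * x \<in> M" "\<And>b. b \<in> B \<Longrightarrow> x * b - b * x \<in> M" for x
  proof -
    have "insert x B \<in> \<B>"
      using B x diff_mem_sym[OF x(2)] zero_mem by (auto simp: \<B>_def)
    then show ?thesis
      using B_max by blast
  qed
  have "maximal_commuting_set M B"
    by unfold_locales (fact B maxB)+
  then show ?thesis
    using that by blast
qed

section \<open>Multilinearization\<close>

definition perm_lists :: "nat \<Rightarrow> nat list set" where
  "perm_lists n = {us. distinct us \<and> set us = {..<n}}"

lemma perm_listsD:
  assumes "us \<in> perm_lists n"
  shows "distinct us" "set us = {..<n}" "length us = n"
  using assms distinct_card[of us] by (auto simp: perm_lists_def)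

lemma finite_perm_lists: "finite (perm_lists n)"
  by (rule finite_subset[OF _ finite_lists_length_eq[of "{..<n}" n]]) (auto dest: perm_listsD)

lemma rev_upt_perm_lists: "rev [0..<n] \<in> perm_lists n"
  by (auto simp: perm_lists_def)

text \<open>Distributivity: \<open>js\<close> records the summand chosen from each factor.\<close>

lemma prod_list_map_sum:
  fixes z :: "'i \<Rightarrow> 'a::{ring,monoid_mult}"
  assumes "finite S"
  shows "prod_list (map (\<lambda>x. \<Sum>j | j \<in> S \<and> p j = x. z j) us) =
    (\<Sum>js | map p js = us \<and> set js \<subseteq> S. prod_list (map z js))"
proof (induction us)
  case Nil
  have "{js. map p js = [] \<and> set js \<subseteq> S} = {[]}"
    by auto
  then show ?case
    by simp
next
  case (Cons x us)
  let ?A = "{j \<in> S. p j = x}" and ?B = "{js. map p js = us \<and> set js \<subseteq> S}"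
  have eq: "{js. map p js = x # us \<and> set js \<subseteq> S} = (\<lambda>(j, js). j # js) ` (?A \<times> ?B)"
    by (auto simp: map_eq_Cons_conv image_iff)
  have inj: "inj_on (\<lambda>(j, js). j # js) (?A \<times> ?B)"
    by (auto simp: inj_on_def)
  show ?case
    unfolding eq sum.reindex[OF inj]
    by (simp add: Cons sum_product sum.cartesian_product case_prod_beta)
qed

text \<open>A proper subset has as many supersets of even size as of odd size. This
  inclusion-exclusion removes the words that miss a letter.\<close>

lemma alternating_sum_supersets:
  assumes "U \<subseteq> {..<n}"
  shows "(\<Sum>S | S \<subseteq> {..<n} \<and> U \<subseteq> S. (- 1) ^ card S) = (if U = {..<n} then (- 1) ^ n else (0::'b::ring_1))"
proof (cases "U = {..<n}")
  case True
  then have "{S. S \<subseteq> {..<n} \<and> U \<subseteq> S} = {{..<n}}"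
    by auto
  then show ?thesis
    using True by simp
next
  case False
  then have "card {S. S \<subseteq> {..<n} \<and> U \<subseteq> S \<and> even (card S)} = card {S. S \<subseteq> {..<n} \<and> U \<subseteq> S \<and> odd (card S)}"
    using assms by (intro card_subsupersets_even_odd) auto
  then show ?thesis
    using False by (simp add: sum_alternating_cancels)
qed

lemma nonconstant_longest_word:
  assumes "nonconstant f"
  obtains w where "w \<in> Poly_Mapping.keys f" "letters w \<noteq> []"
    "\<And>u. u \<in> Poly_Mapping.keys f \<Longrightarrow> length (letters u) \<le> length (letters w)"
proof -
  have "\<exists>u\<in>Poly_Mapping.keys f. letters u \<noteq> []"
  proof (rule ccontr)
    assume *: "\<not> ?thesis"
    have "Poly_Mapping.keys f \<subseteq> {0}"
    proof
      fix u assume "u \<in> Poly_Mapping.keys f"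
      then have "letters u = []"
        using * by blast
      then show "u \<in> {0}"
        by (cases u) (simp add: zero_monomial_def)
    qed
    then have "f = nc_const (Poly_Mapping.lookup f 0)"
      by (intro poly_mapping_eqI) (auto simp: nc_const_def lookup_single when_def in_keys_iff)
    then show False
      using assms by (auto simp: nonconstant_def)
  qed
  then obtain u where u: "u \<in> Poly_Mapping.keys f" "letters u \<noteq> []"
    by blast
  have fin: "finite ((\<lambda>u. length (letters u)) ` Poly_Mapping.keys f)"
    by simp
  obtain w where w: "w \<in> Poly_Mapping.keys f"
    "length (letters w) = Max ((\<lambda>u. length (letters u)) ` Poly_Mapping.keys f)"
    using Max_in[OF fin] u by (metis (no_types, lifting) empty_iff image_iff)
  have "length (letters v) \<le> length (letters w)" if "v \<in> Poly_Mapping.keys f" for v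
    unfolding w(2) using fin that by (intro Max_ge) auto
  then show ?thesis
    using that w(1) u by (metis le_zero_eq length_0_conv)
qed

context unital_algebra
begin


definition multilinear_eval :: "nat \<Rightarrow> (nat list \<Rightarrow> 'f) \<Rightarrow> (nat \<Rightarrow> 'a) \<Rightarrow> 'a" where
  "multilinear_eval n c z = (\<Sum>us\<in>perm_lists n. scale (c us) (prod_list (map z us)))"

text \<open>
  Substituting for each variable \<open>x\<close> the sums of those \<open>z j\<close> with \<open>j \<in> S\<close> and \<open>p j = x\<close>, and
  taking the alternating sum over all \<open>S \<subseteq> {..<n}\<close>, leaves exactly the products that involve every
  \<open>z j\<close>. As \<open>f\<close> has degree at most \<open>n\<close>, these contain every \<open>z j\<close> once.
\<close>

lemma multilinear_eval_in_span_image: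
  fixes f :: "'f free_algebra" and p :: "nat \<Rightarrow> nat"
  assumes deg: "\<And>u. u \<in> Poly_Mapping.keys f \<Longrightarrow> length (letters u) \<le> n"
  shows "multilinear_eval n (\<lambda>us. Poly_Mapping.lookup f (Monomial (map p us))) z
    \<in> span (nc_image scale f)"
proof -
  define C where "C us = Poly_Mapping.lookup f (Monomial (map p us))" for us
  \<comment> \<open>A common finite index set for the expansions of all words of \<open>f\<close>,
    whatever their degree.\<close>
  define W where "W = {us. set us \<subseteq> {..<n} \<and> length us \<le> n}"
  define a where "a S x = (\<Sum>j | j \<in> S \<and> p j = x. z j)" for S x
  define g where "g us = scale (C us) (prod_list (map z us))" for us
  have "finite W"
    unfolding W_def by (rule finite_lists_length_le) simp
  have eval: "nc_eval scale (a S) f = (\<Sum>us\<in>W. if set us \<subseteq> S then g us else 0)" if S: "S \<subseteq> {..<n}" for S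
  proof -
    have "finite S"
      using S finite_subset by blast
    have "prod_list (map (a S) (letters u)) =
        (\<Sum>us\<in>W. if map p us = letters u \<and> set us \<subseteq> S then prod_list (map z us) else 0)"
      if "u \<in> Poly_Mapping.keys f" for u
    proof -
      have "{us. map p us = letters u \<and> set us \<subseteq> S} = {us \<in> W. map p us = letters u \<and> set us \<subseteq> S}"
        using deg[OF that] S by (auto simp: W_def dest: map_eq_imp_length_eq) (metis length_map)
      then show ?thesis
        unfolding a_def prod_list_map_sum[OF \<open>finite S\<close>]
        using \<open>finite W\<close> by (simp add: sum.inter_filter)
    qed
    then have "nc_eval scale (a S) f = (\<Sum>u\<in>Poly_Mapping.keys f. \<Sum>us\<in>W.
        if map p us = letters u \<and> set us \<subseteq> S
        then scale (Poly_Mapping.lookup f u) (prod_list (map z us)) else 0)"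
      unfolding nc_eval_def
      by (intro sum.cong refl) (simp add: scale_sum_right if_distrib[of "scale _"] cong: if_cong)
    also have "\<dots> = (\<Sum>us\<in>W. \<Sum>u\<in>Poly_Mapping.keys f.
        if map p us = letters u \<and> set us \<subseteq> S
        then scale (Poly_Mapping.lookup f u) (prod_list (map z us)) else 0)"
      by (rule sum.swap)
    also have "\<dots> = (\<Sum>us\<in>W. if set us \<subseteq> S then g us else 0)"
    proof (rule sum.cong[OF refl])
      fix us
      \<comment> \<open>Only one monomial can produce the word \<open>us\<close>, so
        \<open>us\<close> appears with coefficient \<open>C us\<close>.\<close>
      have "map p us = letters u \<longleftrightarrow> u = Monomial (map p us)" for u
        by (cases u) auto
      then show "(\<Sum>u\<in>Poly_Mapping.keys f. if map p us = letters u \<and> set us \<subseteq> S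
          then scale (Poly_Mapping.lookup f u) (prod_list (map z us)) else 0) =
          (if set us \<subseteq> S then g us else 0)"
        by (cases "set us \<subseteq> S") (simp_all add: g_def C_def in_keys_iff)
    qed
    finally show ?thesis .
  qed
  \<comment> \<open>A word of length at most \<open>n\<close> that uses all \<open>n\<close> letters
    uses each of them once.\<close>
  have perm: "perm_lists n = {us \<in> W. set us = {..<n}}"
  proof -
    have "distinct us" if "set us = {..<n}" "length us \<le> n" for us
      using that card_length[of us] by (intro card_distinct) simp
    then show ?thesis
      by (auto simp: W_def perm_listsD(3)) (auto simp: perm_lists_def)
  qed
  have "(\<Sum>S | S \<subseteq> {..<n}. scale ((- 1) ^ card S) (nc_eval scale (a S) f)) =
      (\<Sum>S | S \<subseteq> {..<n}. \<Sum>us\<in>W. if set us \<subseteq> S then scale ((- 1) ^ card S) (g us) else 0)"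
    by (intro sum.cong refl) (simp add: eval scale_sum_right if_distrib[of "scale _"] cong: if_cong)
  also have "\<dots> = (\<Sum>us\<in>W. \<Sum>S | S \<subseteq> {..<n}. if set us \<subseteq> S then scale ((- 1) ^ card S) (g us) else 0)"
    by (rule sum.swap)
  also have "\<dots> = (\<Sum>us\<in>W. if set us = {..<n} then scale ((- 1) ^ n) (g us) else 0)"
  proof (rule sum.cong[OF refl])
    fix us assume "us \<in> W"
    then have us: "set us \<subseteq> {..<n}"
      by (simp add: W_def)
    have "(\<Sum>S | S \<subseteq> {..<n}. if set us \<subseteq> S then scale ((- 1) ^ card S) (g us) else 0) =
        (\<Sum>S\<in>{S \<in> {S. S \<subseteq> {..<n}}. set us \<subseteq> S}. scale ((- 1) ^ card S) (g us))"
      by (subst sum.inter_filter) auto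
    also have "\<dots> = scale (\<Sum>S | S \<subseteq> {..<n} \<and> set us \<subseteq> S. (- 1) ^ card S) (g us)"
      by (simp add: scale_sum_left)
    finally show "(\<Sum>S | S \<subseteq> {..<n}. if set us \<subseteq> S then scale ((- 1) ^ card S) (g us) else 0) =
        (if set us = {..<n} then scale ((- 1) ^ n) (g us) else 0)"
      by (simp add: alternating_sum_supersets[OF us])
  qed
  also have "\<dots> = scale ((- 1) ^ n) (\<Sum>us\<in>perm_lists n. g us)"
    using \<open>finite W\<close> by (simp add: perm sum.inter_filter[symmetric] scale_sum_right)
  finally have "scale ((- 1) ^ n) (\<Sum>S | S \<subseteq> {..<n}. scale ((- 1) ^ card S) (nc_eval scale (a S) f)) =
      multilinear_eval n C z"
    by (simp add: multilinear_eval_def g_def power_add[symmetric])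
  moreover have "scale ((- 1) ^ n) (\<Sum>S | S \<subseteq> {..<n}. scale ((- 1) ^ card S) (nc_eval scale (a S) f))
      \<in> span (nc_image scale f)"
    by (intro span_scale span_sum span_base) (auto simp: nc_image_def)
  ultimately show ?thesis
    by (simp add: C_def[abs_def])
qed

end

section \<open>Lie ideals\<close>

text \<open>The Leibniz rule for the derivation [-, x]. As the letters are distinct, each update of
  \<open>z\<close> changes exactly one factor.\<close>

lemma prod_list_commutator:
  fixes x :: "'a::{ring,monoid_mult}"
  assumes "distinct us"
  shows "prod_list (map z us) * x - x * prod_list (map z us) =
    (\<Sum>k\<in>set us. prod_list (map (z(k := z k * x - x * z k)) us))"
  using assms
proof (induction us)
  case (Cons u us)
  let ?z = "\<lambda>k. z(k := z k * x - x * z k)"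
  have "(\<Sum>k\<in>set us. prod_list (map (?z k) (u # us))) = (\<Sum>k\<in>set us. z u * prod_list (map (?z k) us))"
    using Cons.prems by (intro sum.cong) auto
  also have "\<dots> = z u * (prod_list (map z us) * x - x * prod_list (map z us))"
    by (subst Cons.IH) (use Cons.prems in simp, rule sum_distrib_left[symmetric])
  finally have "(\<Sum>k\<in>set us. prod_list (map (?z k) (u # us))) =
      z u * (prod_list (map z us) * x - x * prod_list (map z us))" .
  moreover have "map (?z u) us = map z us"
    using Cons.prems by (intro map_cong) auto
  then have "prod_list (map (?z u) us) = prod_list (map z us)"
    by (rule arg_cong)
  ultimately show ?case
    using Cons.prems by (simp add: algebra_simps del: fun_upd_apply) (simp add: algebra_simps)
qed simp

context unital_algebra
begin

lemma multilinear_eval_commutator: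
  "multilinear_eval n c z * x - x * multilinear_eval n c z =
    (\<Sum>k<n. multilinear_eval n c (z(k := z k * x - x * z k)))"
proof -
  have "multilinear_eval n c z * x - x * multilinear_eval n c z =
      (\<Sum>us\<in>perm_lists n. scale (c us) (prod_list (map z us) * x - x * prod_list (map z us)))"
    by (simp add: multilinear_eval_def sum_distrib_left sum_distrib_right scale_mult_left
        scale_mult_right scale_right_diff_distrib sum_subtractf)
  also have "\<dots> = (\<Sum>us\<in>perm_lists n. \<Sum>k<n. scale (c us) (prod_list (map (z(k := z k * x - x * z k)) us)))"
    by (intro sum.cong refl) (simp add: prod_list_commutator perm_listsD scale_sum_right)
  also have "\<dots> = (\<Sum>k<n. multilinear_eval n c (z(k := z k * x - x * z k)))"
    unfolding multilinear_eval_def by (rule sum.swap)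
  finally show ?thesis .
qed

lemma multilinear_span_lie_ideal:
  assumes "l \<in> span (range (multilinear_eval n c))"
  shows "l * x - x * l \<in> span (range (multilinear_eval n c))"
  using assms
proof (induction rule: span_induct_alt)
  case (step d l y)
  then obtain z where l: "l = multilinear_eval n c z"
    by blast
  have "l * x - x * l \<in> span (range (multilinear_eval n c))"
    unfolding l multilinear_eval_commutator by (intro span_sum span_base) auto
  then have "scale d (l * x - x * l) + (y * x - x * y) \<in> span (range (multilinear_eval n c))"
    using step by (intro span_add span_scale) auto
  then show ?case
    by (simp add: algebra_simps scale_mult_left scale_mult_right scale_right_diff_distrib)
qed (simp add: span_zero)

section \<open>The ideal generated by [L, L]\<close>

definition commutator_ideal :: "'a set \<Rightarrow> 'a set" where
  "commutator_ideal L = span {a * (u * v - v * u) * b | a b u v. u \<in> L \<and> v \<in> L}"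

lemma commutator_ideal_lmult: "x \<in> commutator_ideal L \<Longrightarrow> y * x \<in> commutator_ideal L"
  unfolding commutator_ideal_def
proof (induction rule: span_induct_alt)
  case (step d l x)
  then obtain a b u v where "u \<in> L" "v \<in> L" "l = a * (u * v - v * u) * b"
    by blast
  then have "y * l = (y * a) * (u * v - v * u) * b"
    by (simp add: mult.assoc)
  then have "y * l \<in> span {a * (u * v - v * u) * b | a b u v. u \<in> L \<and> v \<in> L}"
    using \<open>u \<in> L\<close> \<open>v \<in> L\<close> by (intro span_base) blast
  then show ?case
    using step by (simp add: distrib_left scale_mult_right span_add span_scale)
qed (simp add: span_zero)

text \<open>
  Herstein's argument: \<open>N = {x. [x, A] \<subseteq> L}\<close> is a subalgebra that contains \<open>L\<close>, and for
  \<open>u, v \<in> L\<close> it contains \<open>[u, v] a = [u, v a] - v [u, a]\<close>, hence also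
  \<open>a [u, v] b = [u, v] b a - [[u, v] b, a]\<close>.
\<close>

lemma commutator_ideal_commutes:
  assumes L: "subspace L" and lie: "\<And>l x. l \<in> L \<Longrightarrow> l * x - x * l \<in> L"
    and x: "x \<in> commutator_ideal L"
  shows "x * y - y * x \<in> L"
proof -
  define N where "N = {x. \<forall>y. x * y - y * x \<in> L}"
  have NL: "x * y - y * x \<in> L" if "x \<in> N" for x y
    using that by (simp add: N_def)
  have LN: "L \<subseteq> N"
    using lie by (auto simp: N_def)
  have diffN: "x - y \<in> N" if "x \<in> N" "y \<in> N" for x y
  proof -
    have "(x - y) * w - w * (x - y) = (x * w - w * x) - (y * w - w * y)" for w
      by (simp add: algebra_simps)
    then show ?thesis
      using that L by (simp add: N_def subspace_diff)
  qed
  have multN: "x * y \<in> N" if "x \<in> N" "y \<in> N" for x y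
  proof -
    have "(x * y) * w - w * (x * y) = (x * (y * w) - (y * w) * x) + (y * (w * x) - (w * x) * y)" for w
      by (simp add: algebra_simps)
    then show ?thesis
      using that L unfolding N_def by (simp add: subspace_add)
  qed
  have right: "(u * v - v * u) * a \<in> N" if "u \<in> L" "v \<in> L" for u v a
  proof -
    have "(u * v - v * u) * a = (u * (v * a) - (v * a) * u) - v * (u * a - a * u)"
      by (simp add: algebra_simps)
    moreover have "u * (v * a) - (v * a) * u \<in> N" "v * (u * a - a * u) \<in> N"
      using that lie LN multN by blast+
    ultimately show ?thesis
      by (simp add: diffN)
  qed
  have both: "a * (u * v - v * u) * b \<in> N" if "u \<in> L" "v \<in> L" for a b u v
  proof -
    let ?w = "(u * v - v * u) * b"
    have "a * (u * v - v * u) * b = (u * v - v * u) * (b * a) - (?w * a - a * ?w)"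
      by (simp add: algebra_simps)
    moreover have "?w * a - a * ?w \<in> N"
      using NL[OF right[OF that]] LN by blast
    ultimately show ?thesis
      using right[OF that] diffN by simp
  qed
  have "subspace N"
  proof (rule subspaceI)
    show "0 \<in> N"
      using L by (simp add: N_def subspace_0)
    fix x y assume xy: "x \<in> N" "y \<in> N"
    have "(x + y) * w - w * (x + y) = (x * w - w * x) + (y * w - w * y)" for w
      by (simp add: algebra_simps)
    then show "x + y \<in> N"
      using xy L by (simp add: N_def subspace_add)
  next
    fix d x assume x: "x \<in> N"
    have "scale d x * w - w * scale d x = scale d (x * w - w * x)" for w
      by (simp add: scale_mult_left scale_mult_right scale_right_diff_distrib)
    then show "scale d x \<in> N"
      using x L by (simp add: N_def subspace_scale)
  qed
  then have "commutator_ideal L \<subseteq> N"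
    unfolding commutator_ideal_def using both by (intro span_minimal) auto
  then show ?thesis
    using x NL by blast
qed

section \<open>Contradiction at a maximal left ideal\<close>

text \<open>Otherwise [h(x), h(y)] is a multilinear identity of A/M in \<open>2 * n\<close>
  variables. The trace argument gives arbitrarily long independent families, and the staircase then
  forces a nonzero coefficient to vanish.\<close>

lemma multilinear_commutators_not_in_maximal_left_ideal:
  assumes char_0: "\<And>k::nat. 0 < k \<Longrightarrow> (of_nat k :: 'f) \<noteq> 0"
    and one: "1 \<in> commutator_space scale"
    and n: "0 < n" and c: "c (rev [0..<n]) \<noteq> 0"
    and M: "maximal_left_ideal M"
  shows "\<exists>z z' s. (multilinear_eval n c z * multilinear_eval n c z' -
    multilinear_eval n c z' * multilinear_eval n c z) * s \<notin> M"
proof (rule ccontr)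
  assume "\<not> ?thesis"
  then have identity: "(multilinear_eval n c z * multilinear_eval n c z' -
      multilinear_eval n c z' * multilinear_eval n c z) * s \<in> M" for z z' s
    by blast
  obtain B where "maximal_commuting_set M B"
    using maximal_left_ideal.ex_maximal_commuting_set[OF M] .
  then interpret maximal_commuting_set M B .
  have scale_mem: "scale d x \<in> M" if "x \<in> M" for d x
    using lmult_mem[OF that, of "scale d 1"] by (simp add: scale_mult_left)
  have "\<exists>v. indep k v" for k
  proof (induction k)
    case 0
    then show ?case
      by (simp add: indep_def)
  next
    case (Suc k)
    then obtain v where v: "indep k v"
      by blast
    show ?case
    proof (cases "\<exists>x. x \<notin> right_span k v")
      case True
      then show ?thesis
        using indep_extend[OF v] by blast
    next
      case False
      \<comment> \<open>Here A/M has finite dimension \<open>k\<close>, which is positive because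
        the empty span \<open>M\<close> misses 1. The trace then puts \<open>k\<close> times 1 into
        \<open>M\<close>.\<close>
      then have "0 < k"
        using one_notin right_span_0[of v] by (cases k) auto
      have "(\<Sum>i<k. 1) \<in> M"
      proof (rule trace_of_one_mem[OF v])
        show "x \<in> right_span k v" for x
          using False by blast
        fix H :: "'a \<Rightarrow> 'a"
        assume H: "\<And>x y. H (x + y) - (H x + H y) \<in> M" "\<And>x y. H (x * y - y * x) \<in> M"
        have "H 0 \<in> M"
          using H(2)[of 0 0] by simp
        show "H 1 \<in> M"
          using one unfolding commutator_space_def
        proof (induction rule: span_induct_alt)
          case (step d l y)
          then obtain x x' where "l = x * x' - x' * x"
            by blast
          \<comment> \<open>\<open>H\<close> is only additive modulo \<open>M\<close>, so the scalar
            is absorbed into one entry of the commutator.\<close>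
          then have "scale d l = scale d x * x' - x' * scale d x"
            by (simp add: scale_mult_left scale_mult_right scale_right_diff_distrib)
          then have "H (scale d l) \<in> M"
            using H(2) by simp
          then show ?case
            using step H(1) add_mem mem_if_diff_mem by blast
        qed fact
      qed
      then have "scale (1 / of_nat k) (\<Sum>i<k. 1) \<in> M"
        by (rule scale_mem)
      moreover have "(\<Sum>i<k. 1) = scale (of_nat k) 1"
        by (induction k) (simp_all add: scale_left_distrib)
      ultimately show ?thesis
        using char_0[OF \<open>0 < k\<close>] one_notin by simp
    qed
  qed
  \<comment> \<open>A staircase of \<open>2 * n\<close> steps visits \<open>2 * n + 1\<close>
    vectors.\<close>
  then obtain v where v: "indep (Suc (2 * n)) v"
    by blast
  \<comment> \<open>The terms of the commutator: a pair of words, and a truth value for the order of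
    the two factors, which also fixes the sign. Shifting by \<open>n\<close> makes the variables of
    the two copies of h disjoint.\<close>
  define I where "I = (perm_lists n \<times> perm_lists n) \<times> (UNIV :: bool set)"
  define \<phi> where "\<phi> = (\<lambda>((us, us'), b). if b then map ((+) n) us @ us' else us' @ map ((+) n) us)"
  define d where "d = (\<lambda>((us, us'), b). scale ((if b then 1 else - 1) * (c us * c us')) 1)"
  define i0 where "i0 = ((rev [0..<n], rev [0..<n]), True)"
  have "finite I" "i0 \<in> I"
    by (simp_all add: I_def i0_def finite_perm_lists rev_upt_perm_lists)
  have shift: "(+) n ` {..<n} = {n..<2 * n}"
    by (simp add: lessThan_atLeast0 image_add_atLeastLessThan mult_2)
  have "[n..<2 * n] = map ((+) n) [0..<n]"
    by (rule nth_equalityI) auto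
  then have upt: "rev [0..<2 * n] = map ((+) n) (rev [0..<n]) @ rev [0..<n]"
    using upt_add_eq_append[of 0 n n] by (simp add: mult_2 rev_map)
  have "d i0 * v (2 * n) \<in> M"
  proof (rule multilinear_identity_coeff[OF \<open>finite I\<close> \<open>i0 \<in> I\<close> _ _ _ v])
    fix i assume "i \<in> I"
    then obtain us us' b where i: "i = ((us, us'), b)" and us: "us \<in> perm_lists n" "us' \<in> perm_lists n"
      by (auto simp: I_def)
    note D = perm_listsD[OF us(1)] perm_listsD[OF us(2)]
    show "distinct (\<phi> i) \<and> set (\<phi> i) = {..<2 * n}"
    proof -
      have "distinct (map ((+) n) us)" "set (map ((+) n) us) = {n..<2 * n}"
        using D shift by (simp_all add: distinct_map)
      then show ?thesis
        using D(4,5) by (cases b) (auto simp: \<phi>_def i simp del: set_map)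
    qed
    show "\<phi> i = rev [0..<2 * n] \<longleftrightarrow> i = i0"
    proof (cases b)
      case True
      then show ?thesis
        using D by (auto simp: \<phi>_def i i0_def upt inj_map_eq_map)
    next
      case False
      \<comment> \<open>In the opposite order the word begins with letters below \<open>n\<close>,
        whereas \<open>rev [0..<2 * n]\<close> begins with letters from \<open>n\<close> on.\<close>
      have "us' \<noteq> map ((+) n) (rev [0..<n])"
      proof
        assume "us' = map ((+) n) (rev [0..<n])"
        then have "{..<n} = (+) n ` {..<n}"
          using D by (metis set_map set_rev set_upt lessThan_atLeast0)
        then show False
          using n shift by auto
      qed
      then show ?thesis
        using False D by (auto simp: \<phi>_def i i0_def upt)
    qed
  next
    fix z :: "nat \<Rightarrow> 'a" and s
    let ?P = "\<lambda>us. prod_list (map z us)"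
    let ?Q = "\<lambda>us. prod_list (map (\<lambda>j. z (n + j)) us)"
    let ?g = "\<lambda>us us'. scale (c us) (?Q us) * scale (c us') (?P us') * s -
      scale (c us') (?P us') * scale (c us) (?Q us) * s"
    have "d ((us, us'), True) * (?P (\<phi> ((us, us'), True)) * s) +
        d ((us, us'), False) * (?P (\<phi> ((us, us'), False)) * s) = ?g us us'" for us us'
      by (simp add: d_def \<phi>_def comp_def scale_mult_left scale_mult_right mult.assoc mult.commute[of "c us"])
    then have "(\<Sum>i\<in>I. d i * (?P (\<phi> i) * s)) = (\<Sum>us\<in>perm_lists n. \<Sum>us'\<in>perm_lists n. ?g us us')"
      unfolding I_def sum.cartesian_product' by (simp add: UNIV_bool add.commute)
    also have "\<dots> = (\<Sum>us\<in>perm_lists n. \<Sum>us'\<in>perm_lists n. scale (c us) (?Q us) * scale (c us') (?P us')) * s -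
        (\<Sum>us\<in>perm_lists n. \<Sum>us'\<in>perm_lists n. scale (c us') (?P us') * scale (c us) (?Q us)) * s"
      by (simp only: sum_subtractf sum_distrib_right)
    also have "(\<Sum>us\<in>perm_lists n. \<Sum>us'\<in>perm_lists n. scale (c us') (?P us') * scale (c us) (?Q us)) =
        (\<Sum>us'\<in>perm_lists n. \<Sum>us\<in>perm_lists n. scale (c us') (?P us') * scale (c us) (?Q us))"
      by (rule sum.swap)
    also have "(\<Sum>us\<in>perm_lists n. \<Sum>us'\<in>perm_lists n. scale (c us) (?Q us) * scale (c us') (?P us')) * s -
        (\<Sum>us'\<in>perm_lists n. \<Sum>us\<in>perm_lists n. scale (c us') (?P us') * scale (c us) (?Q us)) * s =
        (multilinear_eval n c (\<lambda>j. z (n + j)) * multilinear_eval n c z -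
          multilinear_eval n c z * multilinear_eval n c (\<lambda>j. z (n + j))) * s"
      by (simp only: multilinear_eval_def sum_product left_diff_distrib)
    finally show "(\<Sum>i\<in>I. d i * (?P (\<phi> i) * s)) \<in> M"
      using identity by simp
  qed
  moreover define e where "e = c (rev [0..<n]) * c (rev [0..<n])"
  ultimately have "scale (inverse e) (scale e (v (2 * n))) \<in> M"
    by (intro scale_mem[of "scale e _"]) (simp add: d_def i0_def scale_mult_left)
  moreover have "e \<noteq> 0"
    using c by (simp add: e_def)
  ultimately have "v (2 * n) \<in> M"
    by simp
  then have "v (2 * n) \<in> right_span (2 * n) v"
    by (intro right_spanI[of _ "\<lambda>_. 0"]) (auto simp: zeroB)
  then show False
    using v by (auto simp: indep_def)
qed

end

section \<open>From the longest word of f to the inclusion\<close>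

theorem theorem2p3:
  fixes scale :: "'f::field_char_0 \<Rightarrow> 'a::{ring,monoid_mult} \<Rightarrow> 'a"
    and f :: "'f free_algebra"
  assumes "unital_algebra scale"
    and "1 \<in> commutator_space scale"
    and "nonconstant f"
  shows "commutator_space scale \<subseteq> module.span scale (nc_image scale f)"
proof -
  interpret unital_algebra scale by fact
  obtain w where w: "w \<in> Poly_Mapping.keys f" "letters w \<noteq> []"
    and deg: "\<And>u. u \<in> Poly_Mapping.keys f \<Longrightarrow> length (letters u) \<le> length (letters w)"
    using nonconstant_longest_word[OF assms(3)] by blast
  define n where "n = length (letters w)"
  \<comment> \<open>The positions of \<open>w\<close> are numbered from the right, so that
    \<open>rev [0..<n]\<close>, the word that survives the staircase, is sent to \<open>w\<close>
    and has a nonzero coefficient.\<close>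
  define c where "c us = Poly_Mapping.lookup f (Monomial (map ((!) (rev (letters w))) us))" for us
  define L where "L = span (range (multilinear_eval n c))"
  have "map ((!) (rev (letters w))) (rev [0..<n]) = letters w"
    using map_nth[of "rev (letters w)"] by (simp add: n_def rev_map[symmetric])
  then have c: "c (rev [0..<n]) \<noteq> 0"
    using w by (simp add: c_def in_keys_iff)
  have "L \<subseteq> span (nc_image scale f)"
    unfolding L_def
  proof (rule span_minimal)
    show "range (multilinear_eval n c) \<subseteq> span (nc_image scale f)"
      using multilinear_eval_in_span_image deg unfolding n_def c_def[abs_def] by blast
  qed simp
  have lie: "l * x - x * l \<in> L" if "l \<in> L" for l x
    using that multilinear_span_lie_ideal unfolding L_def by blast
  have "1 \<in> commutator_ideal L"
  proof (rule ccontr)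
    assume "1 \<notin> commutator_ideal L"
    then obtain M where M: "maximal_left_ideal M" "commutator_ideal L \<subseteq> M"
      by (rule ex_maximal_left_ideal[rotated 3])
        (auto simp: commutator_ideal_lmult, auto simp: commutator_ideal_def span_zero span_add)
    have "(multilinear_eval n c z * multilinear_eval n c z' -
        multilinear_eval n c z' * multilinear_eval n c z) * s \<in> commutator_ideal L" for z z' s
    proof -
      have "multilinear_eval n c z \<in> L" "multilinear_eval n c z' \<in> L"
        by (simp_all add: L_def span_base)
      then have "1 * (multilinear_eval n c z * multilinear_eval n c z' -
          multilinear_eval n c z' * multilinear_eval n c z) * s \<in> commutator_ideal L"
        unfolding commutator_ideal_def by (intro span_base) blast
      then show ?thesis
        by simp
    qed
    moreover have "0 < n"
      using w by (simp add: n_def)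
    ultimately show False
      using multilinear_commutators_not_in_maximal_left_ideal[of n c M] assms(2) c M by auto
  qed
  \<comment> \<open>The ideal is all of A, so Herstein's argument puts every commutator into
    \<open>L\<close>.\<close>
  then have "x \<in> commutator_ideal L" for x
    using commutator_ideal_lmult[of 1 L x] by simp
  then have "x * y - y * x \<in> L" for x y
    using commutator_ideal_commutes[OF _ lie] by (simp add: L_def)
  then have "commutator_space scale \<subseteq> L"
    unfolding commutator_space_def by (intro span_minimal) (auto simp: L_def)
  then show ?thesis
    using \<open>L \<subseteq> span (nc_image scale f)\<close> by blast
qed

end
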